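(* For all positive integers $n$ and $e$ such that $2e\le n$, there exist optima $A^E$ and $A^O$ of the $(n,2e)$ and $(n-1,2e-1)$ Delsarte linear programs, respectively, with corresponding Krawtchouk decompositions $b^E=(b_0^E,\dots,b_n^E)$ and $b^O=(b_0^O,\dots,b_{n-1}^O)$, such that the following properties all hold: (i) For all $0\le j\le n$, we have $b_j^E=b_{n-j}^E$. (ii) $b^O=(b_0^E,\dots,b_{n-1}^E)$. (iii) For all even $i\in\{1,\dots,n\}$, we have $A_i^E=A_{i-1}^O+A_i^O$ and $A_{i-1}^O\binom{n-1}{i}=A_i^O\binom{n-1}{i-1}$, where we define $A_i^O=0$ if $i\notin\{0,1,\dots,n-1\}$. (iv) If $A^O$ is the unique optimum of the $(n-1,2e-1)$ Delsarte linear program, then $A^E$ is the unique optimum of the $(n,2e)$ Delsarte linear program.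
   Context: $[a]=\{1,\dots,a\}$ (empty if $a\le 0$). $\binom{a}{b}=0$ unless $0\le b\le a$. For a block length $m$ and $0\le i,j\le m$, the Krawtchouk polynomial is $K_j(i;m)=\sum_{k=0}^j(-1)^k\binom{i}{k}\binom{m-i}{j-k}$. For integers $1\le d\le m$, the $(m,d)$ Delsarte linear program, in real variables $A=(A_0,\dots,A_m)$, is: maximize $\sum_{i=0}^m A_i$ subject to $\sum_{i=0}^m A_iK_j(i;m)\ge 0$ for all $j\in[m]$; $A_i=0$ for all $i\in[d-1]$; $A_0=1$; $A_i\ge 0$ for all $i\in[m]$. An optimum is a feasible point achieving the optimal objective value. The Krawtchouk decomposition of a feasible point $A=(A_0,\dots,A_m)$ (block length $m$) is the vector $b=(b_0,\dots,b_m)$ with $b_j=\frac{1}{\binom{m}{j}}\sum_{i=0}^m A_iK_j(i;m)$; equivalently $A_i=\binom{m}{i}\left(\sum_{j=0}^m b_jK_j(i;m)\right)/2^m$ for all $0\le i\le m$. The Krawtchouk decomposition of $A^E$ uses $m=n$, and that of $A^O$ uses $m=n-1$. *)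

theory Defs
  imports Complex_Main
begin

text \<open>The Krawtchouk polynomial \<open>K\<^sub>j(i; m)\<close>, meant for \<open>i, j \<le> m\<close>; arguments in the
  order in which the notation lists them.\<close>

definition krawtchouk :: "nat \<Rightarrow> nat \<Rightarrow> nat \<Rightarrow> real" where
  "krawtchouk j i m =
     (\<Sum>k=0..j. (-1) ^ k * real (i choose k) * real ((m - i) choose (j - k)))"

text \<open>A vector \<open>(A\<^sub>0, \<dots>, A\<^sub>m)\<close> is a function on \<^typ>\<open>nat\<close> that vanishes beyond \<open>m\<close>.
  So equality of functions is equality of vectors, and out-of-range entries are \<open>0\<close>.\<close>

definition delsarte_feasible :: "nat \<Rightarrow> nat \<Rightarrow> (nat \<Rightarrow> real) \<Rightarrow> bool" where
  "delsarte_feasible m d A \<longleftrightarrow>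
     (\<forall>i>m. A i = 0) \<and>
     (\<forall>j\<in>{1..m}. (\<Sum>i=0..m. A i * krawtchouk j i m) \<ge> 0) \<and>
     (\<forall>i\<in>{1..d - 1}. A i = 0) \<and>
     A 0 = 1 \<and>
     (\<forall>i\<in>{1..m}. A i \<ge> 0)"

definition delsarte_optimum :: "nat \<Rightarrow> nat \<Rightarrow> (nat \<Rightarrow> real) \<Rightarrow> bool" where
  "delsarte_optimum m d A \<longleftrightarrow>
     delsarte_feasible m d A \<and>
     (\<forall>B. delsarte_feasible m d B \<longrightarrow> (\<Sum>i=0..m. B i) \<le> (\<Sum>i=0..m. A i))"

definition unique_delsarte_optimum :: "nat \<Rightarrow> nat \<Rightarrow> (nat \<Rightarrow> real) \<Rightarrow> bool" where
  "unique_delsarte_optimum m d A \<longleftrightarrow>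
     delsarte_optimum m d A \<and> (\<forall>B. delsarte_optimum m d B \<longrightarrow> B = A)"

text \<open>The entry \<open>b\<^sub>j\<close> of the Krawtchouk decomposition of \<open>A\<close>, for \<open>j \<le> m\<close>.\<close>

definition krawtchouk_decomp :: "nat \<Rightarrow> (nat \<Rightarrow> real) \<Rightarrow> nat \<Rightarrow> real" where
  "krawtchouk_decomp m A j = (\<Sum>i=0..m. A i * krawtchouk j i m) / real (m choose j)"

end

theory Submission
  imports Defs "HOL-Analysis.Function_Topology"
begin

text \<open>
  The two programs are linked by the classical passage between codes of length \<open>n\<close> with even
  distance and codes of length \<open>n - 1\<close>. On the level of the linear programs there is a map in each
  direction, and both preserve the objective value.

  Puncturing sends \<open>A\<close> to \<open>A'\<^sub>i = ((n - i) A\<^sub>i + (i + 1) A\<^sub>i\<^sub>+\<^sub>1) / n\<close>: for a distance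
  distribution \<open>A\<close> this is the effect of deleting a uniformly random coordinate. If \<open>A\<close> is read as
  the function \<open>x \<mapsto> A\<^bsub>|x|\<^esub> / (n choose |x|)\<close> on the cube, then \<open>b\<close> is its Fourier transform.
  Deleting a coordinate sums out that coordinate, and so restricts the transform to frequencies that
  vanish there; hence the decomposition loses only its last entry
  (\<open>krawtchouk_decomp_puncture\<close>).

  Extending adds a parity bit: all weight of \<open>A\<^sub>i\<close> moves to \<open>i\<close> rounded up to an even
  number. Then the Krawtchouk sum at \<open>j\<close>, which is \<open>b\<^sub>j (n choose j)\<close>, becomes the sum of the old
  ones at \<open>j\<close> and \<open>n - j\<close> (\<open>krawtchouk_sum_even_extension\<close>), because the parity character exchanges the frequencies
  \<open>j - 1\<close> and \<open>n - j\<close> of the shorter cube. In particular the result is symmetric under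
  \<open>j \<mapsto> n - j\<close>.

  The objective is the Krawtchouk sum at \<open>0\<close>, and both maps fix it; they also preserve
  feasibility, so the optimal values agree. An optimum of the shorter program exists by compactness; its
  extension is \<open>A\<^sup>E\<close>, and the puncturing of \<open>A\<^sup>E\<close> is \<open>A\<^sup>O\<close>. The first two properties are the two
  transform formulas, the third is the formula for puncturing at a vector supported on even
  indices. For the last one, puncturing sends every optimum of the longer program to the unique
  optimum of the shorter one, and it is injective on vectors with a common entry at \<open>0\<close>, since
  \<open>A\<^sub>i\<^sub>+\<^sub>1\<close> can be recovered from \<open>A'\<^sub>i\<close> and \<open>A\<^sub>i\<close>.
\<close>

section \<open>Krawtchouk polynomials\<close>

lemma krawtchouk_0 [simp]: "krawtchouk 0 i m = 1"
  by (simp add: krawtchouk_def)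

lemma krawtchouk_at_0: "krawtchouk j 0 m = real (m choose j)"
proof -
  have "krawtchouk j 0 m = (\<Sum>k\<in>{0}. real (m choose (j - k)))"
    unfolding krawtchouk_def by (rule sum.mono_neutral_cong_right) auto
  then show ?thesis by simp
qed

lemma krawtchouk_eq_0:
  assumes "i \<le> m" and "m < j"
  shows "krawtchouk j i m = 0"
proof -
  have "real (i choose k) * real ((m - i) choose (j - k)) = 0" for k
    using assms by (cases "k \<le> i") (auto simp: binomial_eq_0)
  then show ?thesis
    unfolding krawtchouk_def by (intro sum.neutral ballI) (simp only: mult.assoc mult_zero_right)
qed

text \<open>The number \<open>krawtchouk j i m\<close> is the coefficient of \<open>z\<^sup>j\<close> in \<open>(1 - z)\<^sup>i (1 + z)\<^bsup>m - i\<^esup>\<close>.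
  The next two lemmas multiply this polynomial by \<open>1 + z\<close> and by \<open>1 - z\<close>.\<close>

lemma krawtchouk_Suc_length:
  assumes "i \<le> m"
  shows "krawtchouk (Suc j) i (Suc m) = krawtchouk (Suc j) i m + krawtchouk j i m"
proof -
  have "Suc m - i choose (Suc j - k) = (m - i choose (Suc j - k)) + (m - i choose (j - k))"
    if "k \<le> j" for k
    using assms that by (simp add: Suc_diff_le)
  then show ?thesis
    by (simp add: krawtchouk_def algebra_simps flip: sum.distrib)
qed

lemma krawtchouk_Suc_Suc_length:
  assumes "i \<le> m"
  shows "krawtchouk (Suc j) (Suc i) (Suc m) = krawtchouk (Suc j) i m - krawtchouk j i m"
proof -
  have shift: "krawtchouk (Suc j) i' m' =
      real ((m' - i') choose Suc j) - (\<Sum>k=0..j. (-1) ^ k * real (i' choose Suc k) * real ((m' - i') choose (j - k)))"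
    for i' m'
    unfolding krawtchouk_def by (subst sum.atLeast0_atMost_Suc_shift) (simp add: sum_negf)
  show ?thesis
    unfolding shift by (simp add: krawtchouk_def algebra_simps sum.distrib)
qed

text \<open>Reversing the coefficients of \<open>(1 - z)\<^sup>i (1 + z)\<^bsup>m - i\<^esup>\<close>, that is, substituting \<open>1 / z\<close> and
  multiplying by \<open>z\<^sup>m\<close>, only changes the sign of the \<open>i\<close> factors \<open>1 - z\<close>.\<close>

lemma krawtchouk_reflect:
  assumes "i \<le> m" and "j \<le> m"
  shows "krawtchouk (m - j) i m = (-1) ^ i * krawtchouk j i m"
  using assms
proof (induction i arbitrary: m j)
  case 0
  then show ?case
    by (simp add: krawtchouk_at_0 flip: binomial_symmetric)
next
  case (Suc i)
  then obtain l where l: "m = Suc l" "i \<le> l"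
    by (cases m) auto
  consider "j = 0" | "j = m" | j' where "j = Suc j'" "j' < l"
    using Suc.prems l by (cases j) fastforce+
  then show ?case
  proof cases
    case 1
    then show ?thesis
      using Suc.IH [of l 0] l by (simp add: krawtchouk_Suc_Suc_length krawtchouk_eq_0)
  next
    case 2
    then show ?thesis
      using Suc.IH [of l 0] l
      by (simp add: krawtchouk_Suc_Suc_length krawtchouk_eq_0 flip: power_add)
  next
    case 3
    then have "m - j = Suc (l - Suc j')" "Suc (l - Suc j') = l - j'"
      using l by auto
    then have "krawtchouk (m - j) (Suc i) m = krawtchouk (l - j') i l - krawtchouk (l - Suc j') i l"
      using krawtchouk_Suc_Suc_length [of i l "l - Suc j'"] l by simp
    also have "\<dots> = (-1) ^ Suc i * krawtchouk j (Suc i) m"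
      using Suc.IH [of l j'] Suc.IH [of l "Suc j'"] l 3
      by (simp add: krawtchouk_Suc_Suc_length algebra_simps)
    finally show ?thesis .
  qed
qed

text \<open>This is the value at \<open>z = 1\<close> of the generating polynomial.\<close>

lemma sum_krawtchouk:
  assumes "i \<le> m"
  shows "(\<Sum>j=0..m. krawtchouk j i m) = (if i = 0 then 2 ^ m else 0)"
proof (cases i)
  case 0
  have "(\<Sum>j=0..m. real (m choose j)) = 2 ^ m"
    using choose_row_sum [of m] by (simp add: atLeast0AtMost flip: of_nat_sum)
  then show ?thesis
    by (simp add: 0 krawtchouk_at_0)
next
  case (Suc i')
  with assms obtain l where l: "m = Suc l" "i' \<le> l"
    by (cases m) auto
  have "(\<Sum>j=0..m. krawtchouk j i m) =
      1 + (\<Sum>j=0..l. krawtchouk (Suc j) i' l - krawtchouk j i' l)"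
    unfolding l(1) Suc by (subst sum.atLeast0_atMost_Suc_shift) (simp add: krawtchouk_Suc_Suc_length l)
  also have "\<dots> = krawtchouk (Suc l) i' l"
    by (subst sum_Suc_diff) simp_all
  finally show ?thesis
    using Suc l by (simp add: krawtchouk_eq_0)
qed

lemma real_binomial_absorb_comp:
  "real a * real ((a - 1) choose b) = (real a - real b) * real (a choose b)"
proof (cases "b \<le> a")
  case True
  then show ?thesis
    using arg_cong [OF binomial_absorb_comp [of a b], of real] by simp
qed (simp add: binomial_eq_0)

text \<open>With \<open>F = (1 - z)\<^sup>i (1 + z)\<^bsup>n - i\<^esup>\<close> this compares coefficients in
  \<open>n F - z F' = (n - i) F / (1 + z) + i F / (1 - z)\<close>. Combinatorially, both sides
  are signed counts of pairs of a word of weight \<open>j\<close> and a coordinate outside its support; the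
  left side picks the coordinate first and the right side the word. The identity holds term by
  term on the defining sums. When \<open>i - 1\<close> or \<open>n - 1\<close> is truncated, the factor in front of
  it vanishes.\<close>

lemma krawtchouk_average:
  assumes "i \<le> n" and "j \<le> n"
  shows "(real n - real i) * krawtchouk j i (n - 1) + real i * krawtchouk j (i - 1) (n - 1)
    = (real n - real j) * krawtchouk j i n"
proof -
  have "(real n - real i) * (s * real (i choose k) * real ((n - 1 - i) choose (j - k)))
      + real i * (s * real ((i - 1) choose k) * real ((n - 1 - (i - 1)) choose (j - k)))
      = (real n - real j) * (s * real (i choose k) * real ((n - i) choose (j - k)))"
    if "k \<le> j" for k and s :: real
  proof -
    have 1: "real i * real ((i - 1) choose k) = (real i - real k) * real (i choose k)"
      by (rule real_binomial_absorb_comp)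
    have 2: "(real n - real i) * real ((n - 1 - i) choose (j - k))
        = (real n - real i - (real j - real k)) * real ((n - i) choose (j - k))"
      using real_binomial_absorb_comp [of "n - i" "j - k"] assms that by simp
    have 3: "real i * real ((i - 1) choose k) * real ((n - 1 - (i - 1)) choose (j - k))
        = (real i - real k) * real (i choose k) * real ((n - i) choose (j - k))"
    proof (cases "i = 0")
      case False
      then show ?thesis
        unfolding 1 using assms(1) by (cases n) auto
    qed (cases k; simp)
    have "(real n - real i) * (s * real (i choose k) * real ((n - 1 - i) choose (j - k)))
        = s * real (i choose k) * ((real n - real i) * real ((n - 1 - i) choose (j - k)))"
      by simp
    moreover have "real i * (s * real ((i - 1) choose k) * real ((n - 1 - (i - 1)) choose (j - k)))
        = s * (real i * real ((i - 1) choose k) * real ((n - 1 - (i - 1)) choose (j - k)))"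
      by simp
    ultimately show ?thesis
      unfolding 2 3 by (simp add: algebra_simps)
  qed
  then show ?thesis
    unfolding krawtchouk_def sum_distrib_left sum.distrib [symmetric]
    by (intro sum.cong) auto
qed

text \<open>Appending the parity bit turns an index \<open>i\<close> into \<open>i + i mod 2\<close>.\<close>

lemma krawtchouk_round_up_even:
  assumes "i \<le> m" and "j \<le> Suc m"
  shows "krawtchouk j (i + i mod 2) (Suc m) = krawtchouk j i m + krawtchouk (Suc m - j) i m"
proof (cases j)
  case 0
  then show ?thesis
    using assms by (simp add: krawtchouk_eq_0)
next
  case (Suc j')
  have "krawtchouk (m - j') i m = (-1) ^ i * krawtchouk j' i m"
    using assms Suc by (intro krawtchouk_reflect) auto
  then show ?thesis
    using assms Suc
    by (cases "even i")
      (auto simp: krawtchouk_Suc_length krawtchouk_Suc_Suc_length odd_iff_mod_2_eq_one)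
qed

section \<open>Puncturing and extending\<close>

abbreviation krawtchouk_sum :: "nat \<Rightarrow> (nat \<Rightarrow> real) \<Rightarrow> nat \<Rightarrow> real" where
  "krawtchouk_sum m A j \<equiv> (\<Sum>i=0..m. A i * krawtchouk j i m)"

definition puncture :: "nat \<Rightarrow> (nat \<Rightarrow> real) \<Rightarrow> nat \<Rightarrow> real" where
  "puncture n A i = ((real n - real i) * A i + real (Suc i) * A (Suc i)) / real n"

text \<open>Truncated subtraction makes \<open>A (0 - 1)\<close> equal to \<open>A 0\<close>, so the entry at \<open>0\<close> is
  treated separately.\<close>

definition even_extension :: "(nat \<Rightarrow> real) \<Rightarrow> nat \<Rightarrow> real" where
  "even_extension A i = (if odd i then 0 else if i = 0 then A 0 else A (i - 1) + A i)"

lemma krawtchouk_sum_puncture: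
  assumes "j \<le> Suc m"
  shows "real (Suc m) * krawtchouk_sum m (puncture (Suc m) A) j
    = (real (Suc m) - real j) * krawtchouk_sum (Suc m) A j"
proof -
  let ?n = "Suc m"
  have "real ?n * krawtchouk_sum m (puncture ?n A) j
      = (\<Sum>i=0..m. (real ?n - real i) * A i * krawtchouk j i m)
      + (\<Sum>i=0..m. real (Suc i) * A (Suc i) * krawtchouk j i m)"
    unfolding sum_distrib_left sum.distrib [symmetric]
    by (intro sum.cong) (auto simp: puncture_def field_simps)
  also have "(\<Sum>i=0..m. (real ?n - real i) * A i * krawtchouk j i m)
      = (\<Sum>i=0..?n. (real ?n - real i) * A i * krawtchouk j i m)"
    by simp
  also have "(\<Sum>i=0..m. real (Suc i) * A (Suc i) * krawtchouk j i m)
      = (\<Sum>i=0..?n. real i * A i * krawtchouk j (i - 1) m)"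
    by (subst sum.atLeast0_atMost_Suc_shift) simp
  also have "(\<Sum>i=0..?n. (real ?n - real i) * A i * krawtchouk j i m)
        + (\<Sum>i=0..?n. real i * A i * krawtchouk j (i - 1) m)
      = (\<Sum>i=0..?n. A i * ((real ?n - real i) * krawtchouk j i m + real i * krawtchouk j (i - 1) m))"
    unfolding sum.distrib [symmetric] by (intro sum.cong) (auto simp: algebra_simps)
  also have "\<dots> = (\<Sum>i=0..?n. A i * ((real ?n - real j) * krawtchouk j i ?n))"
    using krawtchouk_average [of _ ?n j] assms by (intro sum.cong) auto
  also have "\<dots> = (real ?n - real j) * krawtchouk_sum ?n A j"
    by (simp add: sum_distrib_left mult.left_commute del: sum.cl_ivl_Suc)
  finally show ?thesis .
qed

text \<open>A sum against \<open>even_extension A\<close> is one against \<open>A\<close> with indices rounded up. If the range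
  ends at an odd \<open>m\<close>, then the term \<open>A m\<close> has moved out of the range on the left.\<close>

lemma sum_even_extension:
  "(\<Sum>i=0..m. even_extension A i * f i) + (if odd m then A m * f (Suc m) else 0)
    = (\<Sum>i=0..m. A i * f (i + i mod 2))"
proof (induction m)
  case 0
  then show ?case by (simp add: even_extension_def)
next
  case (Suc m)
  then show ?case
    by (cases "even m")
      (auto simp: even_extension_def algebra_simps even_iff_mod_2_eq_zero odd_iff_mod_2_eq_one mod_Suc)
qed

lemma krawtchouk_sum_even_extension:
  assumes "A (Suc m) = 0" and "j \<le> Suc m"
  shows "krawtchouk_sum (Suc m) (even_extension A) j
    = krawtchouk_sum m A j + krawtchouk_sum m A (Suc m - j)"
proof -
  have "krawtchouk_sum (Suc m) (even_extension A) j
      = (\<Sum>i=0..m. A i * krawtchouk j (i + i mod 2) (Suc m))"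
    using sum_even_extension [of A "\<lambda>i. krawtchouk j i (Suc m)" "Suc m"] assms(1)
    by (simp cong: if_cong)
  also have "\<dots> = (\<Sum>i=0..m. A i * (krawtchouk j i m + krawtchouk (Suc m - j) i m))"
    using assms(2) by (intro sum.cong) (auto simp: krawtchouk_round_up_even)
  finally show ?thesis
    by (simp add: algebra_simps sum.distrib)
qed

lemma krawtchouk_sum_beyond: "krawtchouk_sum m A (Suc m) = 0"
  by (intro sum.neutral) (auto simp: krawtchouk_eq_0)

lemma puncture_inject:
  assumes "n > 0" and "A 0 = B 0"
    and "\<forall>i>n. A i = 0" and "\<forall>i>n. B i = 0"
    and "puncture n A = puncture n B"
  shows "A = B"
proof
  fix i
  show "A i = B i"
  proof (induction i)
    case 0
    show ?case by fact
  next
    case (Suc i)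
    have "puncture n A i = puncture n B i"
      using assms(5) by simp
    then show ?case
      using Suc assms(1) by (simp add: puncture_def)
  qed
qed

text \<open>Of the two entries that contribute to a punctured entry, only the even one is nonzero.\<close>

lemma puncture_even_extension:
  assumes "even i" and "0 < i" and "i \<le> n"
  shows "puncture n (even_extension A) i = (real n - real i) * even_extension A i / real n"
    and "puncture n (even_extension A) (i - 1) = real i * even_extension A i / real n"
  using assms by (auto simp: puncture_def even_extension_def)

section \<open>Feasible points and optima\<close>

lemma delsarte_feasible_nonneg:
  assumes "delsarte_feasible m d A"
  shows "A i \<ge> 0"
  using assms unfolding delsarte_feasible_def
  by (cases "i = 0"; cases "i \<le> m") (auto simp: not_le)

lemma delsarte_feasible_krawtchouk_sum_nonneg:
  assumes "delsarte_feasible m d A"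
  shows "krawtchouk_sum m A j \<ge> 0"
proof -
  consider "j = 0" | "j \<in> {1..m}" | "j > m"
    by fastforce
  then show ?thesis
  proof cases
    case 1
    then show ?thesis
      using delsarte_feasible_nonneg [OF assms] by (simp add: sum_nonneg)
  next
    case 2
    then show ?thesis
      using assms by (simp add: delsarte_feasible_def)
  next
    case 3
    then show ?thesis
      by (intro sum_nonneg) (auto simp: krawtchouk_eq_0)
  qed
qed

lemma delsarte_feasible_puncture:
  assumes A: "delsarte_feasible (Suc m) (Suc d) A" and "d > 0"
  shows "delsarte_feasible m d (puncture (Suc m) A)"
  unfolding delsarte_feasible_def
proof (intro conjI ballI allI impI)
  have zero: "A i = 0" if "i > Suc m" for i
    using A that by (simp add: delsarte_feasible_def)
  have gap: "A i = 0" if "i \<in> {1..d}" for i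
    using A that by (simp add: delsarte_feasible_def)
  show "puncture (Suc m) A i = 0" if "m < i" for i
    using that zero [of i] zero [of "Suc i"] by (cases "i = Suc m") (auto simp: puncture_def)
  show "krawtchouk_sum m (puncture (Suc m) A) j \<ge> 0" if "j \<in> {1..m}" for j
  proof -
    have "0 \<le> (real (Suc m) - real j) * krawtchouk_sum (Suc m) A j"
      using that delsarte_feasible_krawtchouk_sum_nonneg [OF A] by (intro mult_nonneg_nonneg) auto
    also have "\<dots> = real (Suc m) * krawtchouk_sum m (puncture (Suc m) A) j"
      using that by (subst krawtchouk_sum_puncture) auto
    finally show ?thesis
      by (simp add: zero_le_mult_iff del: sum.cl_ivl_Suc)
  qed
  show "puncture (Suc m) A i = 0" if "i \<in> {1..d - 1}" for i
    using that gap [of i] gap [of "Suc i"] by (auto simp: puncture_def)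
  show "puncture (Suc m) A 0 = 1"
    using A gap [of 1] \<open>d > 0\<close> by (simp add: puncture_def delsarte_feasible_def)
  show "puncture (Suc m) A i \<ge> 0" if "i \<in> {1..m}" for i
    using that delsarte_feasible_nonneg [OF A] by (auto simp: puncture_def)
qed

text \<open>Rounding indices up to even numbers preserves the constraint \<open>A\<^sub>i = 0\<close> for
  \<open>0 < i < 2 e - 1\<close>, and makes the entry at the odd index \<open>2 e - 1\<close> vanish as well.\<close>

lemma delsarte_feasible_even_extension:
  assumes A: "delsarte_feasible m (2 * e - 1) A" and "e > 0"
  shows "delsarte_feasible (Suc m) (2 * e) (even_extension A)"
  unfolding delsarte_feasible_def
proof (intro conjI ballI allI impI)
  have zero: "A i = 0" if "i > m" for i
    using A that by (simp add: delsarte_feasible_def)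
  have gap: "A i = 0" if "0 < i" "i < 2 * e - 1" for i
    using A that by (simp add: delsarte_feasible_def)
  show "even_extension A i = 0" if "Suc m < i" for i
    using that zero by (auto simp: even_extension_def)
  show "krawtchouk_sum (Suc m) (even_extension A) j \<ge> 0" if "j \<in> {1..Suc m}" for j
    using that delsarte_feasible_krawtchouk_sum_nonneg [OF A] zero [of "Suc m"]
    by (subst krawtchouk_sum_even_extension) auto
  show "even_extension A i = 0" if "i \<in> {1..2 * e - 1}" for i
  proof (cases "even i")
    case True
    then have "i - 1 > 0" "i < 2 * e - 1"
      using that \<open>e > 0\<close> by (auto elim!: evenE) presburger
    then show ?thesis
      using gap [of i] gap [of "i - 1"] by (auto simp: even_extension_def)
  qed (simp add: even_extension_def)
  show "even_extension A 0 = 1"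
    using A by (simp add: even_extension_def delsarte_feasible_def)
  show "even_extension A i \<ge> 0" if "i \<in> {1..Suc m}" for i
    using that delsarte_feasible_nonneg [OF A] by (auto simp: even_extension_def)
qed

lemma sum_puncture:
  "(\<Sum>i=0..m. puncture (Suc m) A i) = (\<Sum>i=0..Suc m. A i)"
  using krawtchouk_sum_puncture [of 0 m A] by (simp del: sum.cl_ivl_Suc)

lemma sum_eq_even_extension:
  assumes "A (Suc m) = 0"
  shows "(\<Sum>i=0..Suc m. even_extension A i) = (\<Sum>i=0..m. A i)"
  using krawtchouk_sum_even_extension [of A m 0] assms krawtchouk_sum_beyond [of A m]
  by (simp del: sum.cl_ivl_Suc)

text \<open>Summing the Krawtchouk inequalities over all \<open>j\<close> gives \<open>2\<^sup>m A\<^sub>0\<close>, while the summand at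
  \<open>j = 0\<close> is the objective and the others are nonnegative. So \<open>2\<^sup>m\<close> bounds the objective, and with
  it every entry.\<close>

lemma delsarte_feasible_bounded:
  assumes A: "delsarte_feasible m d A"
  shows "A i \<le> 2 ^ m"
proof -
  have "A i \<le> (\<Sum>i=0..m. A i)"
  proof (cases "i \<le> m")
    case True
    then show ?thesis
      using delsarte_feasible_nonneg [OF A] by (intro member_le_sum) auto
  next
    case False
    then show ?thesis
      using A delsarte_feasible_nonneg [OF A] by (auto simp: delsarte_feasible_def intro: sum_nonneg)
  qed
  also have "\<dots> = krawtchouk_sum m A 0"
    by simp
  also have "\<dots> \<le> (\<Sum>j=0..m. krawtchouk_sum m A j)"
    using delsarte_feasible_krawtchouk_sum_nonneg [OF A]
    by (intro member_le_sum [of 0 _ "krawtchouk_sum m A"]) auto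
  also have "\<dots> = (\<Sum>i=0..m. A i * (\<Sum>j=0..m. krawtchouk j i m))"
    by (subst sum.swap) (simp add: sum_distrib_left)
  also have "\<dots> = (\<Sum>i=0..m. if i = 0 then A 0 * 2 ^ m else 0)"
    by (intro sum.cong) (auto simp: sum_krawtchouk)
  also have "\<dots> = 2 ^ m"
    using A by (simp add: delsarte_feasible_def)
  finally show ?thesis .
qed

text \<open>The feasible set is closed in the product topology on sequences and lies in the box
  \<open>{0..2\<^sup>m}\<^sup>\<nat>\<close>, which is compact by Tychonoff's theorem.\<close>

lemma delsarte_optimum_exists: "\<exists>A. delsarte_optimum m d A"
proof -
  define F where "F = {A. delsarte_feasible m d A}"
  define box where "box = PiE UNIV (\<lambda>i::nat. {0..2 ^ m :: real})"
  have "compact box"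
    using compactin_PiE [of "\<lambda>_. euclidean" UNIV "\<lambda>i::nat. {0..2 ^ m :: real}"]
    by (simp add: box_def euclidean_product_topology)
  moreover have "closed F"
    unfolding F_def delsarte_feasible_def Ball_def
    by (intro closed_Collect_conj closed_Collect_all closed_Collect_imp open_Collect_const
        closed_Collect_le closed_Collect_eq continuous_intros continuous_on_product_coordinates)
  moreover have "F \<subseteq> box"
    using delsarte_feasible_nonneg delsarte_feasible_bounded by (auto simp: F_def box_def)
  ultimately have "compact F"
    by (metis compact_Int_closed inf.absorb2)
  moreover have "(\<lambda>i. if i = 0 then 1 else 0) \<in> F"
    by (auto simp: F_def delsarte_feasible_def krawtchouk_at_0 if_distrib [of "\<lambda>x. x * _"] cong: if_cong)
  then have "F \<noteq> {}"
    by blast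
  moreover have "continuous_on F (\<lambda>A. \<Sum>i=0..m. A i)"
    by (intro continuous_on_sum continuous_on_subset [OF continuous_on_product_coordinates]) auto
  ultimately obtain A where "A \<in> F" "\<forall>B\<in>F. (\<Sum>i=0..m. B i) \<le> (\<Sum>i=0..m. A i)"
    using continuous_attains_sup by blast
  then show ?thesis
    by (auto simp: F_def delsarte_optimum_def)
qed

lemma delsarte_optimum_even_extension:
  assumes A: "delsarte_optimum m (2 * e - 1) A" and "e > 0"
  shows "delsarte_optimum (Suc m) (2 * e) (even_extension A)"
  unfolding delsarte_optimum_def
proof (intro conjI allI impI)
  have F: "delsarte_feasible m (2 * e - 1) A"
    using A by (simp add: delsarte_optimum_def)
  show "delsarte_feasible (Suc m) (2 * e) (even_extension A)"
    using F \<open>e > 0\<close> by (rule delsarte_feasible_even_extension)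
  fix B
  assume "delsarte_feasible (Suc m) (2 * e) B"
  then have "delsarte_feasible m (2 * e - 1) (puncture (Suc m) B)"
    using delsarte_feasible_puncture [of m "2 * e - 1" B] \<open>e > 0\<close> by simp
  then have "(\<Sum>i=0..m. puncture (Suc m) B i) \<le> (\<Sum>i=0..m. A i)"
    using A by (simp add: delsarte_optimum_def)
  moreover have "A (Suc m) = 0"
    using F by (simp add: delsarte_feasible_def)
  ultimately show "(\<Sum>i=0..Suc m. B i) \<le> (\<Sum>i=0..Suc m. even_extension A i)"
    by (simp only: sum_puncture sum_eq_even_extension)
qed

lemma delsarte_optimum_puncture:
  assumes B: "delsarte_optimum (Suc m) (2 * e) B" and "e > 0"
  shows "delsarte_optimum m (2 * e - 1) (puncture (Suc m) B)"
  unfolding delsarte_optimum_def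
proof (intro conjI allI impI)
  show "delsarte_feasible m (2 * e - 1) (puncture (Suc m) B)"
    using delsarte_feasible_puncture [of m "2 * e - 1" B] B \<open>e > 0\<close>
    by (simp add: delsarte_optimum_def)
  fix A
  assume A: "delsarte_feasible m (2 * e - 1) A"
  then have "(\<Sum>i=0..Suc m. even_extension A i) \<le> (\<Sum>i=0..Suc m. B i)"
    using B delsarte_feasible_even_extension [OF A \<open>e > 0\<close>] by (simp only: delsarte_optimum_def)
  moreover have "A (Suc m) = 0"
    using A by (simp add: delsarte_feasible_def)
  ultimately show "(\<Sum>i=0..m. A i) \<le> (\<Sum>i=0..m. puncture (Suc m) B i)"
    by (simp only: sum_puncture sum_eq_even_extension)
qed

lemma krawtchouk_decomp_puncture:
  assumes "j \<le> m"
  shows "krawtchouk_decomp m (puncture (Suc m) A) j = krawtchouk_decomp (Suc m) A j"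
proof -
  have "real (Suc m) * real (m choose j) = (real (Suc m) - real j) * real (Suc m choose j)"
    using real_binomial_absorb_comp [of "Suc m" j] by (simp only: diff_Suc_1)
  moreover have "real (Suc m) * krawtchouk_sum m (puncture (Suc m) A) j
      = (real (Suc m) - real j) * krawtchouk_sum (Suc m) A j"
    using assms by (intro krawtchouk_sum_puncture) auto
  ultimately have "(real (Suc m) * krawtchouk_sum m (puncture (Suc m) A) j) / (real (Suc m) * real (m choose j))
      = ((real (Suc m) - real j) * krawtchouk_sum (Suc m) A j) / ((real (Suc m) - real j) * real (Suc m choose j))"
    by (simp only:)
  moreover have "real (Suc m) \<noteq> 0" "real (Suc m) - real j \<noteq> 0"
    using assms by auto
  ultimately show ?thesis
    unfolding krawtchouk_decomp_def
    by (simp only: mult_divide_mult_cancel_left not_False_eq_True)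
qed

lemma krawtchouk_decomp_even_extension_symmetric:
  assumes "A (Suc m) = 0" and "j \<le> Suc m"
  shows "krawtchouk_decomp (Suc m) (even_extension A) j
    = krawtchouk_decomp (Suc m) (even_extension A) (Suc m - j)"
  unfolding krawtchouk_decomp_def
  using krawtchouk_sum_even_extension [of A m j]
    krawtchouk_sum_even_extension [of A m "Suc m - j"]
    binomial_symmetric [of j "Suc m"] assms
  by (simp del: sum.cl_ivl_Suc)

theorem theorem5p4:
  fixes n e :: nat
  assumes "n > 0" and "e > 0" and "2 * e \<le> n"
  shows "\<exists>AE AO.
    delsarte_optimum n (2 * e) AE \<and>
    delsarte_optimum (n - 1) (2 * e - 1) AO \<and>
    (\<forall>j\<in>{0..n}. krawtchouk_decomp n AE j = krawtchouk_decomp n AE (n - j)) \<and>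
    (\<forall>j\<in>{0..n - 1}. krawtchouk_decomp (n - 1) AO j = krawtchouk_decomp n AE j) \<and>
    (\<forall>i\<in>{1..n}. even i \<longrightarrow>
       AE i = AO (i - 1) + AO i \<and>
       AO (i - 1) * real ((n - 1) choose i) = AO i * real ((n - 1) choose (i - 1))) \<and>
    (unique_delsarte_optimum (n - 1) (2 * e - 1) AO \<longrightarrow>
       unique_delsarte_optimum n (2 * e) AE)"
proof -
  obtain m where n: "n = Suc m"
    using assms(1) by (cases n) auto
  obtain A where A: "delsarte_optimum m (2 * e - 1) A"
    using delsarte_optimum_exists by blast
  have A_end: "A (Suc m) = 0"
    using A by (simp add: delsarte_optimum_def delsarte_feasible_def)
  define AE where "AE = even_extension A"
  define AO where "AO = puncture n AE"
  have AE: "delsarte_optimum n (2 * e) AE"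
    unfolding n AE_def using A assms(2) by (rule delsarte_optimum_even_extension)
  have AO: "delsarte_optimum (n - 1) (2 * e - 1) AO"
    using delsarte_optimum_puncture [of m e AE] AE assms(2) by (simp add: AO_def n)
  have split: "AE i = AO (i - 1) + AO i \<and>
      AO (i - 1) * real ((n - 1) choose i) = AO i * real ((n - 1) choose (i - 1))"
    if "i \<in> {1..n}" "even i" for i
  proof
    have AO_i: "AO i = (real n - real i) * AE i / real n" "AO (i - 1) = real i * AE i / real n"
      using puncture_even_extension [of i n A] that by (auto simp: AO_def AE_def)
    show "AE i = AO (i - 1) + AO i"
      unfolding AO_i using assms(1) by (simp add: field_simps)
    (* Both sides equal (n - 1) * ((n - 2) choose (i - 1)). *)
    have "i * ((n - 1) choose i) = (n - i) * ((n - 1) choose (i - 1))"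
      using times_binomial_minus1_eq [of i "n - 1"] binomial_absorb_comp [of "n - 1" "i - 1"] that
      by simp
    then have "real i * real ((n - 1) choose i) = (real n - real i) * real ((n - 1) choose (i - 1))"
      using that by (simp flip: of_nat_mult of_nat_diff)
    then show "AO (i - 1) * real ((n - 1) choose i) = AO i * real ((n - 1) choose (i - 1))"
      unfolding AO_i by (simp only: times_divide_eq_left mult.commute [of _ "AE i"] mult.assoc)
  qed
  have unique: "unique_delsarte_optimum n (2 * e) AE"
    if U: "unique_delsarte_optimum (n - 1) (2 * e - 1) AO"
    unfolding unique_delsarte_optimum_def
  proof (intro conjI allI impI)
    show "delsarte_optimum n (2 * e) AE" by (rule AE)
    fix B
    assume B: "delsarte_optimum n (2 * e) B"
    then have "delsarte_optimum (n - 1) (2 * e - 1) (puncture n B)"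
      using delsarte_optimum_puncture [of m e B] assms(2) by (simp add: n)
    then have "puncture n B = puncture n AE"
      using U by (simp add: unique_delsarte_optimum_def AO_def)
    moreover have "X 0 = 1 \<and> (\<forall>i>n. X i = 0)" if "delsarte_optimum n (2 * e) X" for X
      using that by (simp add: delsarte_optimum_def delsarte_feasible_def)
    ultimately show "B = AE"
      using puncture_inject [of n B AE] B AE assms(1) by metis
  qed
  show ?thesis
  proof (intro exI conjI ballI impI)
    show "krawtchouk_decomp n AE j = krawtchouk_decomp n AE (n - j)" if "j \<in> {0..n}" for j
      using krawtchouk_decomp_even_extension_symmetric [of A m j] A_end that by (simp add: n AE_def)
    show "krawtchouk_decomp (n - 1) AO j = krawtchouk_decomp n AE j" if "j \<in> {0..n - 1}" for j
      using krawtchouk_decomp_puncture [of j m AE] that by (simp add: n AO_def)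
    show "delsarte_optimum n (2 * e) AE" by (rule AE)
    show "delsarte_optimum (n - 1) (2 * e - 1) AO" by (rule AO)
    show "unique_delsarte_optimum n (2 * e) AE" if "unique_delsarte_optimum (n - 1) (2 * e - 1) AO"
      using that by (rule unique)
  qed (simp_all only: split)
qed

end
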